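(* Let $f:\mathbb{R}^n\to\mathbb{R}$ be twice continuously differentiable, with $L_g$-Lipschitz continuous gradient and $L_H$-Lipschitz continuous Hessian on $\mathbb{R}^n$, and bounded below by a scalar $\bar f\in\mathbb{R}$. Let the Two-Step Method (defined in the context) be run with Hessian approximations, negative curvature directions and gradient approximations satisfying the deterministic inexactness conditions (a), (b), (c) stated in the context, with parameters $\gamma\in(0,1]$, $\delta\in(0,\infty)$, $\theta\in[0,1)$, $\gamma_H\in[0,\gamma)$, $\gamma_\lambda\in[0,1)$, $\hat\theta\in[0,1)$, and with constant step sizes $\alpha>0$, $\beta>0$ satisfying $$\alpha \le \frac{(1-\hat\theta)^2}{L_g(1+\hat\theta)},\qquad \beta\le \frac{\gamma-\gamma_H}{\delta L_H}.$$ If the method terminates finitely in iteration $k\in\mathbb{N}$, then $\nabla f(x_k)=0$ and $\lambda_{\min}(\nabla^2 f(x_k))\ge 0$, i.e., $x_k$ is a second-order stationary point. Otherwise, $$\lim_{k\to\infty}\|\nabla f(x_k)\|_2=0\qquad\text{and}\qquad \liminf_{k\to\infty}\lambda_{\min}(\nabla^2 f(x_k))\ge 0.$$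
   Context: $\lambda_{\min}(A)$ denotes the left-most (smallest) eigenvalue of a symmetric matrix $A$. $\mathbb{N}=\{0,1,2,\dots\}$. Two-Step Method. Given $x_0\in\mathbb{R}^n$, $\alpha>0$, $\beta>0$, for $k=0,1,2,\dots$: 1. Compute a (symmetric) Hessian approximation $H_k\in\mathbb{R}^{n\times n}$ of $\nabla^2 f(x_k)$, with left-most eigenvalue $\lambda_k$, such that condition (b) holds. If $\lambda_k\ge 0$ set $p_k=0$; otherwise compute $q_k$ and set $p_k$ using condition (a). 2. Set $\hat x_k=x_k+\beta p_k$. 3. Compute a gradient approximation $\hat g_k\in\mathbb{R}^n$ at $\hat x_k$ satisfying condition (c), and set $d_k=-\hat g_k$ (so $d_k=0$ if $\hat g_k=0$). 4. If $p_k=d_k=0$, terminate and return $x_k$ (finite termination in iteration $k$). 5. Set $x_{k+1}=\hat x_k+\alpha d_k=x_k+\beta p_k+\alpha d_k$. Conditions, required for every iteration $k$. Write $\lambda_k^-:=\min\{\lambda_k,0\}$ and $\lambda_{\min,k}^-:=\min\{\lambda_{\min}(\nabla^2 f(x_k)),0\}$. (a) If $\lambda_k\ge0$, then $p_k=0$. Otherwise $p_k=q_k$ if $q_k^{\mathsf T}g_k\le 0$ and $p_k=-q_k$ otherwise, where $q_k\in\mathbb{R}^n$ satisfies $q_k^{\mathsf T}H_kq_k\le\gamma\lambda_k\|q_k\|_2^2<0$ and $\|q_k\|_2=\delta|\lambda_k|$, and the gradient approximation $g_k\in\mathbb{R}^n$ satisfies $|(g_k-\nabla f(x_k))^{\mathsf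 T}q_k|\le\theta\,|g_k^{\mathsf T}q_k|$. (b) $\|(H_k-\nabla^2 f(x_k))p_k\|_2\le\gamma_H|\lambda_k^-|\,\|p_k\|_2$ and $|\lambda_k^--\lambda_{\min,k}^-|\le\gamma_\lambda|\lambda_k^-|$. (c) $\|\nabla f(\hat x_k)-\hat g_k\|_2\le\hat\theta\|\hat g_k\|_2$. *)

theory Defs
  imports "HOL-Analysis.Analysis"
begin

definition gradient :: "(real ^ 'n \<Rightarrow> real) \<Rightarrow> real ^ 'n \<Rightarrow> real ^ 'n" where
  "gradient f x = (THE D. GDERIV f x :> D)"

definition hessian :: "(real ^ 'n \<Rightarrow> real) \<Rightarrow> real ^ 'n \<Rightarrow> real ^ 'n ^ 'n" where
  "hessian f x = jacobian (gradient f) (at x)"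

definition twice_continuously_differentiable :: "(real ^ 'n \<Rightarrow> real) \<Rightarrow> bool" where
  "twice_continuously_differentiable f \<longleftrightarrow>
     (\<forall>x. f differentiable (at x)) \<and> (\<forall>x. gradient f differentiable (at x)) \<and>
     continuous_on UNIV (hessian f)"

text \<open>The norm on matrices is the one induced by the Euclidean norm; the type class norm of
  \<^typ>\<open>real ^ 'n ^ 'n\<close> would be the Frobenius norm.\<close>

definition lipschitz_hessian :: "real \<Rightarrow> (real ^ 'n \<Rightarrow> real) \<Rightarrow> bool" where
  "lipschitz_hessian L f \<longleftrightarrow>
     0 \<le> L \<and> (\<forall>x y. onorm ((*v) (hessian f x - hessian f y)) \<le> L * norm (x - y))"

definition symmetric_matrix :: "real ^ 'n ^ 'n \<Rightarrow> bool" where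
  "symmetric_matrix A \<longleftrightarrow> transpose A = A"

definition eigenvalues :: "real ^ 'n ^ 'n \<Rightarrow> real set" where
  "eigenvalues A = {l. \<exists>v. v \<noteq> 0 \<and> A *v v = l *\<^sub>R v}"

text \<open>Only meaningful for symmetric matrices: these have a nonempty, finite set of real
  eigenvalues.\<close>

definition lambda_min :: "real ^ 'n ^ 'n \<Rightarrow> real" where
  "lambda_min A = Min (eigenvalues A)"

definition neg_part :: "real \<Rightarrow> real" where
  "neg_part l = min l 0"

text \<open>The conditions on one iteration: \<open>G\<close> and \<open>W\<close> stand for the exact gradient and Hessian at
  the current iterate, \<open>G'\<close> for the exact gradient at the intermediate point.\<close>

definition curvature_direction_condition ::
  "real \<Rightarrow> real \<Rightarrow> real \<Rightarrow> real ^ 'n \<Rightarrow> real ^ 'n ^ 'n \<Rightarrow> real ^ 'n \<Rightarrow> real ^ 'n \<Rightarrow> real ^ 'n \<Rightarrow> bool"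
  where
  "curvature_direction_condition \<gamma> \<delta> \<theta> G H g q p \<longleftrightarrow>
     (if 0 \<le> lambda_min H then p = 0
      else p = (if q \<bullet> g \<le> 0 then q else - q) \<and>
           q \<bullet> (H *v q) \<le> \<gamma> * lambda_min H * (norm q)\<^sup>2 \<and>
           \<gamma> * lambda_min H * (norm q)\<^sup>2 < 0 \<and>
           norm q = \<delta> * \<bar>lambda_min H\<bar> \<and>
           \<bar>(g - G) \<bullet> q\<bar> \<le> \<theta> * \<bar>g \<bullet> q\<bar>)"

definition hessian_condition ::
  "real \<Rightarrow> real \<Rightarrow> real ^ 'n ^ 'n \<Rightarrow> real ^ 'n ^ 'n \<Rightarrow> real ^ 'n \<Rightarrow> bool" where
  "hessian_condition \<gamma>\<^sub>H \<gamma>\<^sub>l W H p \<longleftrightarrow>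
     norm ((H - W) *v p) \<le> \<gamma>\<^sub>H * \<bar>neg_part (lambda_min H)\<bar> * norm p \<and>
     \<bar>neg_part (lambda_min H) - neg_part (lambda_min W)\<bar> \<le> \<gamma>\<^sub>l * \<bar>neg_part (lambda_min H)\<bar>"

definition gradient_condition :: "real \<Rightarrow> real ^ 'n \<Rightarrow> real ^ 'n \<Rightarrow> bool" where
  "gradient_condition \<theta>' G' g' \<longleftrightarrow> norm (G' - g') \<le> \<theta>' * norm g'"

text \<open>A run is given by sequences of iterates \<open>x\<close>, Hessian approximations \<open>H\<close>, gradient
  approximations \<open>g\<close> (at \<open>x\<close>) and \<open>g'\<close> (at the intermediate points \<open>x + \<beta> p\<close>), and directions
  \<open>q\<close>, \<open>p\<close>; the step \<open>d k\<close> is \<open>- g' k\<close>. Nothing is required of the entries of these sequences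
  beyond the iteration in which the method stops.\<close>

definition stops_at :: "(nat \<Rightarrow> real ^ 'n) \<Rightarrow> (nat \<Rightarrow> real ^ 'n) \<Rightarrow> nat \<Rightarrow> bool" where
  "stops_at p g' k \<longleftrightarrow> p k = 0 \<and> - g' k = 0"

definition iteration_reached :: "(nat \<Rightarrow> real ^ 'n) \<Rightarrow> (nat \<Rightarrow> real ^ 'n) \<Rightarrow> nat \<Rightarrow> bool" where
  "iteration_reached p g' k \<longleftrightarrow> (\<forall>j<k. \<not> stops_at p g' j)"

definition terminates_in :: "(nat \<Rightarrow> real ^ 'n) \<Rightarrow> (nat \<Rightarrow> real ^ 'n) \<Rightarrow> nat \<Rightarrow> bool" where
  "terminates_in p g' k \<longleftrightarrow> iteration_reached p g' k \<and> stops_at p g' k"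

definition two_step_run ::
  "(real ^ 'n \<Rightarrow> real) \<Rightarrow> real ^ 'n \<Rightarrow> real \<Rightarrow> real \<Rightarrow>
   real \<Rightarrow> real \<Rightarrow> real \<Rightarrow> real \<Rightarrow> real \<Rightarrow> real \<Rightarrow>
   (nat \<Rightarrow> real ^ 'n) \<Rightarrow> (nat \<Rightarrow> real ^ 'n ^ 'n) \<Rightarrow> (nat \<Rightarrow> real ^ 'n) \<Rightarrow>
   (nat \<Rightarrow> real ^ 'n) \<Rightarrow> (nat \<Rightarrow> real ^ 'n) \<Rightarrow> (nat \<Rightarrow> real ^ 'n) \<Rightarrow> bool" where
  "two_step_run f x\<^sub>0 \<alpha> \<beta> \<gamma> \<delta> \<theta> \<gamma>\<^sub>H \<gamma>\<^sub>l \<theta>' x H g q p g' \<longleftrightarrow>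
     x 0 = x\<^sub>0 \<and>
     (\<forall>k. iteration_reached p g' k \<longrightarrow>
        symmetric_matrix (H k) \<and>
        curvature_direction_condition \<gamma> \<delta> \<theta> (gradient f (x k)) (H k) (g k) (q k) (p k) \<and>
        hessian_condition \<gamma>\<^sub>H \<gamma>\<^sub>l (hessian f (x k)) (H k) (p k) \<and>
        gradient_condition \<theta>' (gradient f (x k + \<beta> *\<^sub>R p k)) (g' k) \<and>
        (\<not> stops_at p g' k \<longrightarrow> x (Suc k) = x k + \<beta> *\<^sub>R p k + \<alpha> *\<^sub>R (- g' k)))"

end

theory Submission
  imports Defs
begin

text \<open>The two halves of an iteration each decrease \<open>f\<close>, by an amount that controls one of the two
  quantities in the conclusion.

  Write \<open>\<lambda>\<close> for the negative part of the left-most eigenvalue of \<open>H k\<close>. The curvature step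
  \<open>\<beta> p\<close> has length \<open>\<beta> \<delta> \<bar>\<lambda>\<bar>\<close>. By the sign choice for \<open>p\<close> and the relative accuracy of \<open>g\<close>, it is
  not an ascent direction, and by the relative accuracy of \<open>H k\<close> the exact Hessian has curvature
  at most \<open>- (\<gamma> - \<gamma>\<^sub>H) \<bar>\<lambda>\<bar>\<close> along it. In the cubic Taylor bound, the bound on \<open>\<beta>\<close> makes the remainder
  at most a third of the quadratic gain, so \<open>f\<close> drops by a multiple of \<open>\<bar>\<lambda>\<bar>\<^sup>3\<close>
  (\<open>curvature_step_decrease\<close>). The gradient step uses the quadratic Taylor bound in the same way and
  drops \<open>f\<close> by a multiple of \<open>(norm (g' k))\<^sup>2\<close> (\<open>gradient_step_decrease\<close>).

  As \<open>f\<close> is bounded below, both decreases tend to zero, and hence so do \<open>\<lambda>\<close> and \<open>g' k\<close>. The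
  relative error conditions carry this over to the exact quantities: the left-most eigenvalue of
  the exact Hessian is at least \<open>- (1 + \<gamma>\<^sub>l) \<bar>\<lambda>\<bar>\<close>, and the exact gradient at the intermediate point
  has norm at most \<open>(1 + \<theta>') norm (g' k)\<close>, while the intermediate point is within
  \<open>\<beta> \<delta> \<bar>\<lambda>\<bar>\<close> of \<open>x k\<close> (\<open>gradient_bound\<close>, \<open>lambda_min_bound\<close>). The same two bounds with \<open>\<lambda> = 0\<close>
  and \<open>g' k = 0\<close> settle finite termination.\<close>

section \<open>Derivatives along a segment\<close>

lemma gradient_has_derivative:
  fixes f :: "real ^ 'n \<Rightarrow> real"
  assumes "f differentiable (at x)"
  shows "(f has_derivative (\<lambda>h. h \<bullet> gradient f x)) (at x)"
proof -
  from assms obtain f' where f': "(f has_derivative f') (at x)"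
    by (auto simp: differentiable_def)
  then have "f' = (\<lambda>h. h \<bullet> adjoint f' 1)"
    by (simp add: adjoint_works has_derivative_linear)
  with f' have "GDERIV f x :> adjoint f' 1"
    by (simp add: gderiv_def)
  moreover have "D = D'" if "GDERIV f x :> D" "GDERIV f x :> D'" for D D'
  proof -
    have "(\<lambda>h. h \<bullet> D) = (\<lambda>h. h \<bullet> D')"
      using that unfolding gderiv_def by (rule has_derivative_unique)
    then show ?thesis
      by (metis vector_eq_ldot)
  qed
  ultimately have "GDERIV f x :> gradient f x"
    unfolding gradient_def by (metis theI)
  then show ?thesis
    by (simp add: gderiv_def)
qed

lemma DERIV_along_line:
  fixes f :: "real ^ 'n \<Rightarrow> real"
  assumes "\<And>y. f differentiable (at y)"
  shows "((\<lambda>t. f (x + t *\<^sub>R d)) has_real_derivative gradient f (x + t *\<^sub>R d) \<bullet> d) (at t)"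
proof -
  have "((\<lambda>t. x + t *\<^sub>R d) has_derivative (\<lambda>s. s *\<^sub>R d)) (at t)"
    by (auto intro!: derivative_eq_intros)
  from has_derivative_compose[OF this gradient_has_derivative[OF assms]]
  show ?thesis
    by (simp add: has_field_derivative_def inner_commute mult.commute[of _ "d \<bullet> _"])
qed

lemma DERIV_gradient_along_line:
  fixes f :: "real ^ 'n \<Rightarrow> real"
  assumes "\<And>y. gradient f differentiable (at y)"
  shows "((\<lambda>t. gradient f (x + t *\<^sub>R d) \<bullet> d) has_real_derivative
            d \<bullet> (hessian f (x + t *\<^sub>R d) *v d)) (at t)"
proof -
  have line: "((\<lambda>t. x + t *\<^sub>R d) has_derivative (\<lambda>s. s *\<^sub>R d)) (at t)"
    by (auto intro!: derivative_eq_intros)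
  have "(gradient f has_derivative (\<lambda>h. hessian f (x + t *\<^sub>R d) *v h)) (at (x + t *\<^sub>R d))"
    using assms jacobian_works unfolding hessian_def by blast
  from has_derivative_inner_left[OF has_derivative_compose[OF line this], of d]
  show ?thesis
    by (simp add: has_field_derivative_def inner_commute mult.commute[of _ "d \<bullet> _"]
        matrix_vector_mult_scaleR del: scaleR_matrix_vector_assoc)
qed

section \<open>Taylor upper bounds under Lipschitz derivatives\<close>

text \<open>One integration of a quadratic bound on the slope. Both Taylor bounds come from it, applied to
  \<open>f\<close> along a segment: once for the quadratic one, and for the cubic one twice, first to the
  directional derivative and then to \<open>f\<close> itself.\<close>

lemma integrate_derivative_bound:
  fixes \<phi> \<phi>' :: "real \<Rightarrow> real"
  assumes "\<And>t. (\<phi> has_real_derivative \<phi>' t) (at t)"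
    and "\<And>t. 0 \<le> t \<Longrightarrow> \<phi>' t \<le> a + b * t + c * t\<^sup>2"
    and "0 \<le> s"
  shows "\<phi> s \<le> \<phi> 0 + a * s + b * s\<^sup>2 / 2 + c * s ^ 3 / 3"
proof -
  let ?\<psi> = "\<lambda>t. \<phi> t - (a * t + b * t\<^sup>2 / 2 + c * t ^ 3 / 3)"
  have "?\<psi> s \<le> ?\<psi> 0"
  proof (rule DERIV_nonpos_imp_nonincreasing[OF assms(3)])
    fix t :: real
    assume "0 \<le> t"
    have "(?\<psi> has_real_derivative \<phi>' t - (a + b * t + c * t\<^sup>2)) (at t)"
      by (auto intro!: derivative_eq_intros assms(1))
    moreover have "\<phi>' t - (a + b * t + c * t\<^sup>2) \<le> 0"
      using assms(2)[OF \<open>0 \<le> t\<close>] by simp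
    ultimately show "\<exists>y. (?\<psi> has_real_derivative y) (at t) \<and> y \<le> 0"
      by (intro exI conjI)
  qed
  then show ?thesis
    by simp
qed

lemma quadratic_upper_bound:
  fixes f :: "real ^ 'n \<Rightarrow> real"
  assumes diff: "\<And>y. f differentiable (at y)"
    and lip: "L-lipschitz_on UNIV (gradient f)"
  shows "f (x + d) \<le> f x + gradient f x \<bullet> d + L / 2 * (norm d)\<^sup>2"
proof -
  have "gradient f (x + t *\<^sub>R d) \<bullet> d \<le> gradient f x \<bullet> d + L * (norm d)\<^sup>2 * t + 0 * t\<^sup>2"
    if "0 \<le> t" for t
  proof -
    have "(gradient f (x + t *\<^sub>R d) - gradient f x) \<bullet> d
        \<le> norm (gradient f (x + t *\<^sub>R d) - gradient f x) * norm d"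
      by (rule norm_cauchy_schwarz)
    also have "\<dots> \<le> (L * norm (t *\<^sub>R d)) * norm d"
      using lipschitz_onD[OF lip, of "x + t *\<^sub>R d" x]
      by (intro mult_right_mono) (auto simp: dist_norm)
    finally show ?thesis
      using that by (simp add: inner_diff_left power2_eq_square mult_ac)
  qed
  from integrate_derivative_bound[OF DERIV_along_line[OF diff] this, of 1]
  show ?thesis
    by simp
qed

lemma cubic_upper_bound:
  fixes f :: "real ^ 'n \<Rightarrow> real"
  assumes diff: "\<And>y. f differentiable (at y)"
    and diff2: "\<And>y. gradient f differentiable (at y)"
    and lip: "lipschitz_hessian L f"
  shows "f (x + d) \<le> f x + gradient f x \<bullet> d + d \<bullet> (hessian f x *v d) / 2 + L / 6 * norm d ^ 3"
proof -
  let ?W = "\<lambda>t. hessian f (x + t *\<^sub>R d)"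
  have "d \<bullet> (?W t *v d) \<le> d \<bullet> (hessian f x *v d) + L * norm d ^ 3 * t + 0 * t\<^sup>2"
    if "0 \<le> t" for t
  proof -
    have "d \<bullet> ((?W t - hessian f x) *v d) \<le> norm d * norm ((?W t - hessian f x) *v d)"
      by (rule norm_cauchy_schwarz)
    also have "\<dots> \<le> norm d * (onorm ((*v) (?W t - hessian f x)) * norm d)"
      by (intro mult_left_mono onorm matrix_vector_mul_bounded_linear norm_ge_zero)
    also have "\<dots> \<le> norm d * ((L * norm (t *\<^sub>R d)) * norm d)"
    proof -
      have "onorm ((*v) (?W t - hessian f x)) \<le> L * norm (x + t *\<^sub>R d - x)"
        using lip unfolding lipschitz_hessian_def by blast
      then show ?thesis
        by (intro mult_left_mono mult_right_mono) auto
    qed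
    finally show ?thesis
      using that
      by (simp add: inner_diff_right matrix_vector_mult_diff_rdistrib power3_eq_cube mult_ac)
  qed
  from integrate_derivative_bound[OF DERIV_gradient_along_line[OF diff2] this]
  have "gradient f (x + t *\<^sub>R d) \<bullet> d
      \<le> gradient f x \<bullet> d + d \<bullet> (hessian f x *v d) * t + L * norm d ^ 3 / 2 * t\<^sup>2"
    if "0 \<le> t" for t
    using that by simp
  from integrate_derivative_bound[OF DERIV_along_line[OF diff] this, of 1]
  show ?thesis
    by simp
qed

section \<open>Decrease in one iteration\<close>

lemma norm_curvature_direction:
  assumes "curvature_direction_condition \<gamma> \<delta> \<theta> G H g q p"
  shows "norm p = \<delta> * \<bar>neg_part (lambda_min H)\<bar>"
proof (cases "0 \<le> lambda_min H")
  case False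
  then have "norm p = norm q" "norm q = \<delta> * \<bar>lambda_min H\<bar>"
    using assms by (simp_all add: curvature_direction_condition_def)
  with False show ?thesis
    by (simp add: neg_part_def)
qed (use assms in \<open>simp add: curvature_direction_condition_def neg_part_def\<close>)

text \<open>The error of \<open>g\<close> along \<open>q\<close> is relative to \<open>\<bar>g \<bullet> q\<bar>\<close> with a factor below one, so it cannot
  change the sign of the slope.\<close>

lemma curvature_direction_nonascent:
  assumes "curvature_direction_condition \<gamma> \<delta> \<theta> G H g q p" and "\<theta> < 1"
  shows "G \<bullet> p \<le> 0"
proof (cases "0 \<le> lambda_min H")
  case True
  with assms(1) show ?thesis
    by (simp add: curvature_direction_condition_def)
next
  case False
  then have p: "p = (if q \<bullet> g \<le> 0 then q else - q)"
    and err: "\<bar>g \<bullet> q - G \<bullet> q\<bar> \<le> \<theta> * \<bar>g \<bullet> q\<bar>"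
    using assms(1) by (simp_all add: curvature_direction_condition_def inner_diff_left)
  have "\<theta> * \<bar>g \<bullet> q\<bar> \<le> \<bar>g \<bullet> q\<bar>"
    using mult_right_mono[of \<theta> 1 "\<bar>g \<bullet> q\<bar>"] assms(2) by simp
  with err have "g \<bullet> q \<le> 0 \<longrightarrow> G \<bullet> q \<le> 0" "0 \<le> g \<bullet> q \<longrightarrow> 0 \<le> G \<bullet> q"
    by linarith+
  then show ?thesis
    unfolding p by (simp add: inner_commute[of q])
qed

text \<open>The approximate curvature is at most \<open>- \<gamma> \<bar>\<lambda>\<bar>\<close> per unit of \<open>(norm p)\<^sup>2\<close>, where \<open>\<lambda>\<close> is the negative
  part of \<open>lambda_min H\<close>, and replacing \<open>H\<close> by \<open>W\<close> costs at most \<open>\<gamma>\<^sub>H \<bar>\<lambda>\<bar>\<close> by Cauchy-Schwarz.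
  The sign in \<open>p = \<plusminus> q\<close> is invisible to a quadratic form.\<close>

lemma curvature_along_direction:
  assumes dir: "curvature_direction_condition \<gamma> \<delta> \<theta> G H g q p"
    and hess: "hessian_condition \<gamma>\<^sub>H \<gamma>\<^sub>l W H p"
  shows "p \<bullet> (W *v p) \<le> - (\<gamma> - \<gamma>\<^sub>H) * \<bar>neg_part (lambda_min H)\<bar> * (norm p)\<^sup>2"
proof (cases "0 \<le> lambda_min H")
  case True
  with dir show ?thesis
    by (simp add: curvature_direction_condition_def)
next
  case False
  let ?l = "\<bar>neg_part (lambda_min H)\<bar>"
  have l: "lambda_min H = - ?l"
    using False by (simp add: neg_part_def)
  have p: "p = (if q \<bullet> g \<le> 0 then q else - q)"
    and q: "q \<bullet> (H *v q) \<le> \<gamma> * lambda_min H * (norm q)\<^sup>2"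
    using dir unfolding curvature_direction_condition_def if_not_P[OF False] by blast+
  have "H *v (- q) = - (H *v q)"
    using matrix_vector_mult_scaleR[of H "- 1" q] by simp
  with p have "p \<bullet> (H *v p) = q \<bullet> (H *v q)" "norm p = norm q"
    by simp_all
  with q have "p \<bullet> (H *v p) \<le> \<gamma> * lambda_min H * (norm p)\<^sup>2"
    by presburger
  then have approx: "p \<bullet> (H *v p) \<le> - \<gamma> * ?l * (norm p)\<^sup>2"
    by (subst (asm) l) simp
  have "- (p \<bullet> ((H - W) *v p)) \<le> norm p * norm ((H - W) *v p)"
    using Cauchy_Schwarz_ineq2[of p "(H - W) *v p"] by linarith
  also have "\<dots> \<le> norm p * (\<gamma>\<^sub>H * ?l * norm p)"
    using hess by (intro mult_left_mono) (auto simp: hessian_condition_def)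
  finally have "p \<bullet> (W *v p) \<le> p \<bullet> (H *v p) + \<gamma>\<^sub>H * ?l * (norm p)\<^sup>2"
    by (simp add: inner_diff_right matrix_vector_mult_diff_rdistrib power2_eq_square mult_ac)
  with approx show ?thesis
    by (simp add: algebra_simps)
qed

text \<open>The quadratic gain is \<open>(\<gamma> - \<gamma>\<^sub>H) \<beta>\<^sup>2 \<delta>\<^sup>2 l\<^sup>3 / 2\<close> with \<open>l = \<bar>neg_part (lambda_min H)\<bar>\<close>; the cubic
  remainder is \<open>L \<beta>\<^sup>3 \<delta>\<^sup>3 l\<^sup>3 / 6\<close>, and \<open>\<beta> \<delta> L \<le> \<gamma> - \<gamma>\<^sub>H\<close> bounds it by a third of the gain.\<close>

lemma curvature_step_decrease:
  fixes f :: "real ^ 'n \<Rightarrow> real"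
  assumes diff: "\<And>y. f differentiable (at y)" "\<And>y. gradient f differentiable (at y)"
    and lip: "lipschitz_hessian L f"
    and dir: "curvature_direction_condition \<gamma> \<delta> \<theta> (gradient f x) H g q p"
    and hess: "hessian_condition \<gamma>\<^sub>H \<gamma>\<^sub>l (hessian f x) H p"
    and \<theta>: "\<theta> < 1" and \<delta>: "0 \<le> \<delta>"
    and \<beta>: "0 \<le> \<beta>" "\<beta> * \<delta> * L \<le> \<gamma> - \<gamma>\<^sub>H"
  shows "f (x + \<beta> *\<^sub>R p)
      \<le> f x - \<beta>\<^sup>2 * \<delta>\<^sup>2 * (\<gamma> - \<gamma>\<^sub>H) / 3 * \<bar>neg_part (lambda_min H)\<bar> ^ 3"
proof -
  define l where "l = \<bar>neg_part (lambda_min H)\<bar>"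
  have np: "norm p = \<delta> * l"
    using norm_curvature_direction[OF dir] by (simp add: l_def)
  have "gradient f x \<bullet> (\<beta> *\<^sub>R p) \<le> 0"
    using curvature_direction_nonascent[OF dir \<theta>] \<beta>(1) by (simp add: mult_nonneg_nonpos)
  moreover have "(\<beta> *\<^sub>R p) \<bullet> (hessian f x *v (\<beta> *\<^sub>R p)) \<le> \<beta>\<^sup>2 * (- (\<gamma> - \<gamma>\<^sub>H) * l * (\<delta> * l)\<^sup>2)"
  proof -
    have "\<beta>\<^sup>2 * (p \<bullet> (hessian f x *v p)) \<le> \<beta>\<^sup>2 * (- (\<gamma> - \<gamma>\<^sub>H) * l * (\<delta> * l)\<^sup>2)"
      using curvature_along_direction[OF dir hess]
      by (intro mult_left_mono) (auto simp: np l_def)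
    then show ?thesis
      by (simp add: matrix_vector_mult_scaleR power2_eq_square mult.assoc)
  qed
  moreover have "L / 6 * norm (\<beta> *\<^sub>R p) ^ 3 \<le> \<beta>\<^sup>2 * \<delta>\<^sup>2 * l ^ 3 * (\<gamma> - \<gamma>\<^sub>H) / 6"
  proof -
    have "L / 6 * norm (\<beta> *\<^sub>R p) ^ 3 = \<beta>\<^sup>2 * \<delta>\<^sup>2 * l ^ 3 * (\<beta> * \<delta> * L) / 6"
      using \<beta>(1) by (simp add: np power2_eq_square power3_eq_cube)
    also have "\<dots> \<le> \<beta>\<^sup>2 * \<delta>\<^sup>2 * l ^ 3 * (\<gamma> - \<gamma>\<^sub>H) / 6"
      using \<beta>(2) by (intro divide_right_mono mult_left_mono) (auto simp: l_def)
    finally show ?thesis .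
  qed
  moreover note cubic_upper_bound[OF diff lip, of x "\<beta> *\<^sub>R p"]
  ultimately have "f (x + \<beta> *\<^sub>R p) \<le> f x + \<beta>\<^sup>2 * (- (\<gamma> - \<gamma>\<^sub>H) * l * (\<delta> * l)\<^sup>2) / 2
      + \<beta>\<^sup>2 * \<delta>\<^sup>2 * l ^ 3 * (\<gamma> - \<gamma>\<^sub>H) / 6"
    by linarith
  also have "\<dots> = f x - \<beta>\<^sup>2 * \<delta>\<^sup>2 * (\<gamma> - \<gamma>\<^sub>H) / 3 * l ^ 3"
    by (simp add: field_simps power2_eq_square power3_eq_cube)
  finally show ?thesis
    by (simp add: l_def)
qed

text \<open>The relative error leaves a slope of at most \<open>- (1 - \<theta>') (norm g')\<^sup>2\<close> along \<open>- g'\<close>, and the step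
  size bound makes the quadratic term at most half of that.\<close>

lemma gradient_step_decrease:
  fixes f :: "real ^ 'n \<Rightarrow> real"
  assumes diff: "\<And>y. f differentiable (at y)"
    and lip: "L-lipschitz_on UNIV (gradient f)"
    and grad: "gradient_condition \<theta>' (gradient f y) g'"
    and \<alpha>: "0 \<le> \<alpha>" "\<alpha> * L \<le> 1 - \<theta>'"
  shows "f (y + \<alpha> *\<^sub>R (- g')) \<le> f y - \<alpha> * (1 - \<theta>') / 2 * (norm g')\<^sup>2"
proof -
  have "(g' - gradient f y) \<bullet> g' \<le> norm (gradient f y - g') * norm g'"
    using norm_cauchy_schwarz[of "g' - gradient f y" g'] by (simp add: norm_minus_commute)
  also have "\<dots> \<le> (\<theta>' * norm g') * norm g'"
    using grad by (intro mult_right_mono) (auto simp: gradient_condition_def)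
  finally have "(1 - \<theta>') * (norm g')\<^sup>2 \<le> gradient f y \<bullet> g'"
    by (simp add: inner_diff_left dot_square_norm algebra_simps power2_eq_square)
  from mult_left_mono[OF this \<alpha>(1)]
  have slope: "\<alpha> * ((1 - \<theta>') * (norm g')\<^sup>2) \<le> \<alpha> * (gradient f y \<bullet> g')" .
  have "L / 2 * (norm (\<alpha> *\<^sub>R (- g')))\<^sup>2 = (\<alpha> * L) * (\<alpha> * (norm g')\<^sup>2 / 2)"
    by (simp add: power_mult_distrib power2_eq_square)
  also have "\<dots> \<le> (1 - \<theta>') * (\<alpha> * (norm g')\<^sup>2 / 2)"
    using \<alpha> by (intro mult_right_mono) auto
  finally have "L / 2 * (norm (\<alpha> *\<^sub>R (- g')))\<^sup>2 \<le> (1 - \<theta>') * (\<alpha> * (norm g')\<^sup>2 / 2)" .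
  moreover have "gradient f y \<bullet> (\<alpha> *\<^sub>R (- g')) = - (\<alpha> * (gradient f y \<bullet> g'))"
    by simp
  moreover note slope quadratic_upper_bound[OF diff lip, of y "\<alpha> *\<^sub>R (- g')"]
  ultimately have "f (y + \<alpha> *\<^sub>R (- g'))
      \<le> f y - \<alpha> * ((1 - \<theta>') * (norm g')\<^sup>2) + (1 - \<theta>') * (\<alpha> * (norm g')\<^sup>2 / 2)"
    by linarith
  also have "\<dots> = f y - \<alpha> * (1 - \<theta>') / 2 * (norm g')\<^sup>2"
    by (simp add: field_simps)
  finally show ?thesis .
qed

section \<open>From the approximations to the exact quantities\<close>

lemma gradient_bound:
  fixes f :: "real ^ 'n \<Rightarrow> real"
  assumes lip: "L-lipschitz_on UNIV (gradient f)"
    and dir: "curvature_direction_condition \<gamma> \<delta> \<theta> G H g q p"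
    and grad: "gradient_condition \<theta>' (gradient f (x + \<beta> *\<^sub>R p)) g'"
    and \<beta>: "0 \<le> \<beta>"
  shows "norm (gradient f x)
      \<le> (1 + \<theta>') * norm g' + L * \<beta> * \<delta> * \<bar>neg_part (lambda_min H)\<bar>"
proof -
  let ?y = "x + \<beta> *\<^sub>R p"
  have "norm (gradient f x) \<le> norm (gradient f x - gradient f ?y)
      + norm (gradient f ?y - g') + norm g'"
    using norm_triangle_sub[of "gradient f x" "gradient f ?y"]
      norm_triangle_sub[of "gradient f ?y" g'] by linarith
  moreover have "norm (gradient f x - gradient f ?y)
      \<le> L * \<beta> * \<delta> * \<bar>neg_part (lambda_min H)\<bar>"
    using lipschitz_onD[OF lip, of x ?y] \<beta> norm_curvature_direction[OF dir]
    by (simp add: dist_norm)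
  moreover have "norm (gradient f ?y - g') \<le> \<theta>' * norm g'"
    using grad by (simp add: gradient_condition_def)
  ultimately show ?thesis
    by (simp add: algebra_simps)
qed

lemma lambda_min_bound:
  assumes "hessian_condition \<gamma>\<^sub>H \<gamma>\<^sub>l W H p"
  shows "- ((1 + \<gamma>\<^sub>l) * \<bar>neg_part (lambda_min H)\<bar>) \<le> lambda_min W"
proof -
  have "neg_part (lambda_min W) \<le> lambda_min W"
    by (simp add: neg_part_def)
  moreover have "\<bar>neg_part (lambda_min H) - neg_part (lambda_min W)\<bar>
      \<le> \<gamma>\<^sub>l * \<bar>neg_part (lambda_min H)\<bar>"
    using assms by (simp add: hessian_condition_def)
  ultimately show ?thesis
    unfolding distrib_right by linarith
qed

section \<open>Convergence\<close>

lemma decrease_tendsto_0: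
  fixes F a :: "nat \<Rightarrow> real"
  assumes dec: "\<And>k. F (Suc k) \<le> F k - a k" and nonneg: "\<And>k. 0 \<le> a k"
    and below: "\<And>k. B \<le> F k"
  shows "a \<longlonglongrightarrow> 0"
proof -
  have "decseq F"
  proof (rule decseq_SucI)
    show "F (Suc k) \<le> F k" for k
      using dec[of k] nonneg[of k] by linarith
  qed
  then obtain l where l: "F \<longlonglongrightarrow> l"
    using decseq_convergent below by blast
  have "(\<lambda>k. F k - F (Suc k)) \<longlonglongrightarrow> l - l"
    by (intro tendsto_diff l LIMSEQ_Suc)
  then have lim: "(\<lambda>k. F k - F (Suc k)) \<longlonglongrightarrow> 0"
    by simp
  show ?thesis
  proof (rule tendsto_sandwich[OF _ _ tendsto_const lim])
    show "\<forall>\<^sub>F k in sequentially. a k \<le> F k - F (Suc k)"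
      using dec by (intro always_eventually allI) (simp add: algebra_simps)
  qed (use nonneg in simp)
qed

lemma tendsto_0_of_scaled_power:
  fixes u :: "nat \<Rightarrow> real"
  assumes lim: "(\<lambda>k. c * u k ^ m) \<longlonglongrightarrow> 0" and "0 < c" "0 < m" and nonneg: "\<And>k. 0 \<le> u k"
  shows "u \<longlonglongrightarrow> 0"
proof -
  have "(\<lambda>k. root m (c * u k ^ m / c)) \<longlonglongrightarrow> root m (0 / c)"
    using \<open>0 < c\<close> by (intro tendsto_real_root tendsto_divide lim tendsto_const) auto
  then show ?thesis
    using assms by (simp add: real_root_power_cancel)
qed

theorem theorem2p10:
  fixes f :: "real ^ 'n \<Rightarrow> real"
    and fbar L\<^sub>g L\<^sub>H \<alpha> \<beta> \<gamma> \<delta> \<theta> \<gamma>\<^sub>H \<gamma>\<^sub>l \<theta>' :: real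
    and x\<^sub>0 :: "real ^ 'n"
    and x g q p g' :: "nat \<Rightarrow> real ^ 'n"
    and H :: "nat \<Rightarrow> real ^ 'n ^ 'n"
  assumes "twice_continuously_differentiable f"
    and "L\<^sub>g-lipschitz_on UNIV (gradient f)"
    and "lipschitz_hessian L\<^sub>H f"
    and "\<And>y. fbar \<le> f y"
    and "0 < \<gamma>" "\<gamma> \<le> 1"
    and "0 < \<delta>"
    and "0 \<le> \<theta>" "\<theta> < 1"
    and "0 \<le> \<gamma>\<^sub>H" "\<gamma>\<^sub>H < \<gamma>"
    and "0 \<le> \<gamma>\<^sub>l" "\<gamma>\<^sub>l < 1"
    and "0 \<le> \<theta>'" "\<theta>' < 1"
    and "0 < \<alpha>" "\<alpha> \<le> (1 - \<theta>')\<^sup>2 / (L\<^sub>g * (1 + \<theta>'))"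
    and "0 < \<beta>" "\<beta> \<le> (\<gamma> - \<gamma>\<^sub>H) / (\<delta> * L\<^sub>H)"
    and "two_step_run f x\<^sub>0 \<alpha> \<beta> \<gamma> \<delta> \<theta> \<gamma>\<^sub>H \<gamma>\<^sub>l \<theta>' x H g q p g'"
  shows "(\<forall>k. terminates_in p g' k \<longrightarrow>
             gradient f (x k) = 0 \<and> lambda_min (hessian f (x k)) \<ge> 0) \<and>
         ((\<nexists>k. terminates_in p g' k) \<longrightarrow>
             (\<lambda>k. norm (gradient f (x k))) \<longlonglongrightarrow> 0 \<and>
             liminf (\<lambda>k. ereal (lambda_min (hessian f (x k)))) \<ge> 0)"
proof -
  have diff: "\<And>y. f differentiable (at y)" "\<And>y. gradient f differentiable (at y)"
    using assms(1) by (auto simp: twice_continuously_differentiable_def)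
  note lip = \<open>L\<^sub>g-lipschitz_on UNIV (gradient f)\<close>
  note lipH = \<open>lipschitz_hessian L\<^sub>H f\<close>
  \<comment> \<open>The step size bound is divided by \<open>1 + \<theta>' \<ge> 1\<close> and multiplied by \<open>(1 - \<theta>')\<^sup>2 \<le> 1 - \<theta>'\<close>, so it
    is stronger than what the gradient step uses.\<close>
  have step_\<alpha>: "\<alpha> * L\<^sub>g \<le> 1 - \<theta>'"
  proof (cases "L\<^sub>g = 0")
    case False
    then have "0 < L\<^sub>g"
      using lipschitz_on_nonneg[OF lip] by simp
    then have "\<alpha> * L\<^sub>g * (1 + \<theta>') \<le> (1 - \<theta>')\<^sup>2"
      using \<open>\<alpha> \<le> (1 - \<theta>')\<^sup>2 / (L\<^sub>g * (1 + \<theta>'))\<close> \<open>0 \<le> \<theta>'\<close> by (simp add: pos_le_divide_eq mult.assoc)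
    moreover have "\<alpha> * L\<^sub>g * 1 \<le> \<alpha> * L\<^sub>g * (1 + \<theta>')"
      using \<open>0 < L\<^sub>g\<close> \<open>0 < \<alpha>\<close> \<open>0 \<le> \<theta>'\<close> by (intro mult_left_mono) auto
    moreover have "(1 - \<theta>')\<^sup>2 \<le> 1 - \<theta>'"
      using \<open>0 \<le> \<theta>'\<close> \<open>\<theta>' < 1\<close> by (simp add: power2_eq_square mult_left_le)
    ultimately show ?thesis
      by simp
  qed (use \<open>\<theta>' < 1\<close> in simp)
  have step_\<beta>: "\<beta> * \<delta> * L\<^sub>H \<le> \<gamma> - \<gamma>\<^sub>H"
  proof (cases "L\<^sub>H = 0")
    case False
    then have "0 < \<delta> * L\<^sub>H"
      using lipH \<open>0 < \<delta>\<close> by (simp add: lipschitz_hessian_def)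
    then show ?thesis
      using \<open>\<beta> \<le> (\<gamma> - \<gamma>\<^sub>H) / (\<delta> * L\<^sub>H)\<close> by (simp add: pos_le_divide_eq mult.assoc)
  qed (use \<open>\<gamma>\<^sub>H < \<gamma>\<close> in simp)
  define l where "l k = \<bar>neg_part (lambda_min (H k))\<bar>" for k
  have dir: "curvature_direction_condition \<gamma> \<delta> \<theta> (gradient f (x k)) (H k) (g k) (q k) (p k)"
    and hess: "hessian_condition \<gamma>\<^sub>H \<gamma>\<^sub>l (hessian f (x k)) (H k) (p k)"
    and grad: "gradient_condition \<theta>' (gradient f (x k + \<beta> *\<^sub>R p k)) (g' k)"
    and iter: "\<not> stops_at p g' k \<Longrightarrow> x (Suc k) = x k + \<beta> *\<^sub>R p k + \<alpha> *\<^sub>R (- g' k)"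
    if "iteration_reached p g' k" for k
    using that \<open>two_step_run f x\<^sub>0 \<alpha> \<beta> \<gamma> \<delta> \<theta> \<gamma>\<^sub>H \<gamma>\<^sub>l \<theta>' x H g q p g'\<close>
    by (auto simp: two_step_run_def)
  have gbound: "norm (gradient f (x k)) \<le> (1 + \<theta>') * norm (g' k) + L\<^sub>g * \<beta> * \<delta> * l k"
    if "iteration_reached p g' k" for k
    using gradient_bound[OF lip dir[OF that] grad[OF that]] \<open>0 < \<beta>\<close> by (simp add: l_def)
  have lbound: "- ((1 + \<gamma>\<^sub>l) * l k) \<le> lambda_min (hessian f (x k))"
    if "iteration_reached p g' k" for k
    using lambda_min_bound[OF hess[OF that]] by (simp add: l_def)
  show ?thesis
  proof (intro conjI allI impI)
    fix k
    assume "terminates_in p g' k"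
    then have k: "iteration_reached p g' k" and "p k = 0" "g' k = 0"
      by (auto simp: terminates_in_def stops_at_def)
    have "l k = 0"
      using norm_curvature_direction[OF dir[OF k]] \<open>p k = 0\<close> \<open>0 < \<delta>\<close> by (simp add: l_def)
    then show "gradient f (x k) = 0" "lambda_min (hessian f (x k)) \<ge> 0"
      using gbound[OF k] lbound[OF k] \<open>g' k = 0\<close> by auto
  next
    assume "\<nexists>k. terminates_in p g' k"
    \<comment> \<open>The conditions of a run apply to reached iterations; without termination these are all.\<close>
    have reached: "iteration_reached p g' k" for k
    proof (induction k)
      case (Suc k)
      with \<open>\<nexists>k. terminates_in p g' k\<close> show ?case
        by (auto simp: iteration_reached_def terminates_in_def less_Suc_eq)
    qed (simp add: iteration_reached_def)
    then have cont: "\<not> stops_at p g' k" for k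
      using \<open>\<nexists>k. terminates_in p g' k\<close> by (auto simp: terminates_in_def)
    define c where "c = \<beta>\<^sup>2 * \<delta>\<^sup>2 * (\<gamma> - \<gamma>\<^sub>H) / 3"
    define e where "e = \<alpha> * (1 - \<theta>') / 2"
    have "0 < c" "0 < e"
      using \<open>0 < \<beta>\<close> \<open>0 < \<delta>\<close> \<open>\<gamma>\<^sub>H < \<gamma>\<close> \<open>0 < \<alpha>\<close> \<open>\<theta>' < 1\<close> by (auto simp: c_def e_def)
    have l_nonneg: "0 \<le> l k" for k
      by (simp add: l_def)
    have terms_nonneg: "0 \<le> c * l k ^ 3" "0 \<le> e * norm (g' k) ^ 2" for k
      using \<open>0 < c\<close> \<open>0 < e\<close> l_nonneg by simp_all
    have dec: "f (x (Suc k)) \<le> f (x k) - c * l k ^ 3 - e * norm (g' k) ^ 2" for k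
    proof -
      have "f (x (Suc k)) \<le> f (x k + \<beta> *\<^sub>R p k) - e * norm (g' k) ^ 2"
        using gradient_step_decrease[OF diff(1) lip grad[OF reached] _ step_\<alpha>] \<open>0 < \<alpha>\<close>
        unfolding iter[OF reached cont] e_def by simp
      also have "f (x k + \<beta> *\<^sub>R p k) \<le> f (x k) - c * l k ^ 3"
        using curvature_step_decrease[OF diff lipH dir[OF reached] hess[OF reached]
            \<open>\<theta> < 1\<close> _ _ step_\<beta>] \<open>0 < \<delta>\<close> \<open>0 < \<beta>\<close>
        unfolding c_def l_def by simp
      finally show ?thesis
        by simp
    qed
    have "(\<lambda>k. c * l k ^ 3) \<longlonglongrightarrow> 0"
    proof (rule decrease_tendsto_0[where F = "\<lambda>k. f (x k)"])
      show "f (x (Suc k)) \<le> f (x k) - c * l k ^ 3" for k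
        using dec[of k] terms_nonneg(2)[of k] by linarith
    qed (use terms_nonneg assms(4) in auto)
    then have l0: "l \<longlonglongrightarrow> 0"
      by (rule tendsto_0_of_scaled_power) (use \<open>0 < c\<close> l_nonneg in auto)
    have "(\<lambda>k. e * norm (g' k) ^ 2) \<longlonglongrightarrow> 0"
    proof (rule decrease_tendsto_0[where F = "\<lambda>k. f (x k)"])
      show "f (x (Suc k)) \<le> f (x k) - e * norm (g' k) ^ 2" for k
        using dec[of k] terms_nonneg(1)[of k] by linarith
    qed (use terms_nonneg assms(4) in auto)
    then have g0: "(\<lambda>k. norm (g' k)) \<longlonglongrightarrow> 0"
      by (rule tendsto_0_of_scaled_power) (use \<open>0 < e\<close> in auto)
    have "(\<lambda>k. (1 + \<theta>') * norm (g' k) + L\<^sub>g * \<beta> * \<delta> * l k)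
        \<longlonglongrightarrow> (1 + \<theta>') * 0 + L\<^sub>g * \<beta> * \<delta> * 0"
      by (intro tendsto_intros g0 l0)
    then have up: "(\<lambda>k. (1 + \<theta>') * norm (g' k) + L\<^sub>g * \<beta> * \<delta> * l k) \<longlonglongrightarrow> 0"
      by simp
    show "(\<lambda>k. norm (gradient f (x k))) \<longlonglongrightarrow> 0"
      by (rule tendsto_sandwich[OF _ _ tendsto_const up]) (use gbound reached in auto)
    have "(\<lambda>k. ereal (- ((1 + \<gamma>\<^sub>l) * l k))) \<longlonglongrightarrow> ereal (- ((1 + \<gamma>\<^sub>l) * 0))"
      by (intro tendsto_intros l0)
    then have "liminf (\<lambda>k. ereal (- ((1 + \<gamma>\<^sub>l) * l k))) = 0"
      by (intro lim_imp_Liminf) (auto simp: zero_ereal_def)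
    moreover have "liminf (\<lambda>k. ereal (- ((1 + \<gamma>\<^sub>l) * l k)))
        \<le> liminf (\<lambda>k. ereal (lambda_min (hessian f (x k))))"
      using lbound reached by (intro Liminf_mono always_eventually) auto
    ultimately show "liminf (\<lambda>k. ereal (lambda_min (hessian f (x k)))) \<ge> 0"
      by simp
  qed
qed

end
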